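(* Let $k=2-\sqrt{3}$, $\alpha=\arcsin\sqrt{k}$, and $$I=\int_0^\infty\frac{dx}{(1+x^2)^{3/2}\bigl[\varphi(x)+\sqrt{\varphi(x)}\bigr]^{1/2}},\qquad \varphi(x)=1+\frac{4x^2}{3(1+x^2)^2}.$$ Then $$\sqrt{2}\;I=(\sqrt{3}-1)\,\Pi\bigl(\tfrac{\pi}{2},k,3^{-1/2}\bigr)-F\bigl(\alpha,3^{-1/2}\bigr).$$
   Context: Notation for elliptic integrals (Gradshteyn–Ryzhik convention; the last argument is the modulus $\ell$, and the second argument $\nu$ of $\Pi$ is the coefficient of $x^2$): $$F(\phi,\ell)=\int_0^{\sin\phi}\frac{dx}{\sqrt{(1-x^2)(1-\ell^2x^2)}},\qquad \Pi(\phi,\nu,\ell)=\int_0^{\sin\phi}\frac{dx}{(1-\nu x^2)\sqrt{(1-x^2)(1-\ell^2x^2)}}.$$ Thus, explicitly, $F(\alpha,3^{-1/2})=\int_0^{\sqrt{k}}\frac{dx}{\sqrt{(1-x^2)(1-\frac13x^2)}}$ and $\Pi(\pi/2,k,3^{-1/2})=\int_0^1\frac{dx}{(1-kx^2)\sqrt{(1-x^2)(1-\frac13x^2)}}$. *)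

theory Defs
  imports "HOL-Analysis.Analysis"
begin

text \<open>
  Legendre elliptic integrals in the Gradshteyn--Ryzhik convention: the last argument is the
  modulus \<open>l\<close> (not the parameter \<open>m = l\<^sup>2\<close>), and \<open>\<nu>\<close> is the coefficient
  of \<open>x\<^sup>2\<close> in the factor \<open>1 - \<nu> * x\<^sup>2\<close>, with a minus sign. The interval integral is
  oriented, so negative amplitudes are covered as well; as in the algebraic form of the
  definition, the amplitude enters only through its sine and is meant to lie between
  \<open>- pi / 2\<close> and \<open>pi / 2\<close>.
\<close>

definition elliptic_F :: "real \<Rightarrow> real \<Rightarrow> real" where
  "elliptic_F \<phi> l =
     (LBINT x=0..ereal (sin \<phi>). 1 / sqrt ((1 - x\<^sup>2) * (1 - l\<^sup>2 * x\<^sup>2)))"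

definition elliptic_Pi :: "real \<Rightarrow> real \<Rightarrow> real \<Rightarrow> real" where
  "elliptic_Pi \<phi> \<nu> l =
     (LBINT x=0..ereal (sin \<phi>).
        1 / ((1 - \<nu> * x\<^sup>2) * sqrt ((1 - x\<^sup>2) * (1 - l\<^sup>2 * x\<^sup>2))))"

end

theory Submission
  imports Defs
begin

text \<open>
  Put \<open>x = tan \<theta>\<close>. Reflecting \<open>\<theta>\<close> in \<open>\<pi>/4\<close>, that is, folding \<open>x\<close> onto \<open>1/x\<close>, leaves
  an integral over \<open>(0, 1)\<close> that depends on \<open>w = sin (2 * \<theta>)\<close> only. The substitution
  \<open>w = sqrt 3 * tan (2 * \<gamma> - \<pi>/6)\<close> turns \<open>sqrt 2 * I\<close> into
  \<open>\<integral> sqrt 2 / (cos (\<gamma> - \<pi>/12) * R (2 * sin \<gamma>)) d\<gamma>\<close> over \<open>(\<pi>/12, \<pi>/6)\<close>, where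
  \<open>R t = sqrt ((1 - t\<^sup>2) * (1 - t\<^sup>2/3))\<close>. Rationalising \<open>cos (\<gamma> - \<pi>/12)\<close> splits this into two
  elliptic integrals. In the first, \<open>t = 2 * sin \<gamma>\<close> gives \<open>\<Pi>\<close> over \<open>(sqrt k, 1)\<close>; in the second,
  \<open>t\<^sup>2 = (1 - 4 * (sin \<gamma>)\<^sup>2) / (3 - 4 * (sin \<gamma>)\<^sup>2)\<close> gives a combination of \<open>F\<close> and \<open>\<Pi>\<close> over
  \<open>(0, sqrt k)\<close>, which supplies the missing part of the complete \<open>\<Pi>\<close>.
\<close>

subsection \<open>Absolutely convergent integrals\<close>

text \<open>Integrability and value are kept in one predicate, in the shape of the
  change-of-variables theorem for absolutely integrable functions, so that every substitution
  carries both at once.\<close>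

definition has_abs_integral :: "(real \<Rightarrow> real) \<Rightarrow> real \<Rightarrow> real set \<Rightarrow> bool" where
  "has_abs_integral f I S \<longleftrightarrow> f absolutely_integrable_on S \<and> integral S f = I"

lemma has_abs_integral_continuous:
  assumes "continuous_on {a..b} f"
  shows "has_abs_integral f (integral {a<..<b} f) {a<..<b}"
  using absolutely_integrable_on_open_interval[of a b f]
    absolutely_integrable_continuous_real[OF assms]
  by (simp add: has_abs_integral_def)

lemma has_abs_integral_subset:
  assumes "has_abs_integral f I S" "T \<subseteq> S" "T \<in> sets lebesgue"
  shows "has_abs_integral f (integral T f) T"
  using assms set_integrable_subset[of lebesgue S f T] by (simp add: has_abs_integral_def)

lemma has_abs_integral_cong:
  assumes "\<And>x. x \<in> S \<Longrightarrow> f x = g x"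
  shows "has_abs_integral f I S \<longleftrightarrow> has_abs_integral g I S"
  using set_integrable_cong[of lebesgue lebesgue S S f g] integral_cong[of S f g] assms
  by (simp add: has_abs_integral_def)

lemma has_abs_integral_diff:
  assumes "has_abs_integral f I S" "has_abs_integral g J S"
  shows "has_abs_integral (\<lambda>x. f x - g x) (I - J) S"
  using assms set_lebesgue_integral_eq_integral(1)
  by (auto simp: has_abs_integral_def intro!: set_integral_diff integral_diff)

lemma has_abs_integral_cmult:
  assumes "has_abs_integral f I S"
  shows "has_abs_integral (\<lambda>x. c * f x) (c * I) S"
  using assms by (auto simp: has_abs_integral_def)

lemma has_abs_integral_Un:
  assumes "has_abs_integral f I S" "has_abs_integral f J T" "S \<inter> T = {}"
  shows "has_abs_integral f (I + J) (S \<union> T)"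
proof -
  have "(f has_integral I) S" "(f has_integral J) T"
    using assms set_lebesgue_integral_eq_integral(1)[of S f] set_lebesgue_integral_eq_integral(1)[of T f]
    by (auto simp: has_abs_integral_def has_integral_integrable_integral)
  then have "(f has_integral I + J) (S \<union> T)"
    using assms(3) by (intro has_integral_Un) simp_all
  then show ?thesis
    using assms absolutely_integrable_Un[of S f T] by (auto simp: has_abs_integral_def integral_unique)
qed

text \<open>A single point is negligible. This lets the open intervals produced by the substitutions
  be glued at a common endpoint.\<close>

lemma has_abs_integral_insert:
  "has_abs_integral f I (insert a S) \<longleftrightarrow> has_abs_integral f I S"
proof -
  have neg: "negligible {x \<in> insert a S - S. f x \<noteq> 0}" "negligible {x \<in> S - insert a S. f x \<noteq> 0}"
    by (auto intro: negligible_subset[of "{a}"])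
  show ?thesis
    unfolding has_abs_integral_def
    using absolutely_integrable_spike_set_eq[OF neg] integral_spike_set[OF neg] by metis
qed

lemma has_abs_integral_unique:
  "has_abs_integral f I S \<Longrightarrow> has_abs_integral f J S \<Longrightarrow> I = J"
  by (simp add: has_abs_integral_def)

text \<open>Bridge from gauge integrals to the integrals of the theorem: for a Borel integrand,
  passing from \<open>lborel\<close> to its completion \<open>lebesgue\<close> does not change the
  value.\<close>

lemma lborel_integral_eq_has_abs_integral:
  assumes "has_abs_integral f I S" "S \<in> sets borel" "f \<in> borel_measurable borel"
  shows "(LBINT x:S. f x) = I"
proof -
  have "(\<lambda>x. indicator S x *\<^sub>R f x) \<in> borel_measurable lborel"
    using assms(2,3) by simp
  then have "(LBINT x:S. f x) = (LINT x:S|lebesgue. f x)"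
    unfolding set_lebesgue_integral_def by (rule integral_completion[symmetric])
  then show ?thesis
    using assms(1) set_lebesgue_integral_eq_integral(2)[of S f] by (simp add: has_abs_integral_def)
qed

section \<open>Monotone substitutions on open intervals\<close>

lemma strict_mono_image_open_interval:
  fixes g :: "real \<Rightarrow> real"
  assumes "a < b" and cont: "continuous_on {a..b} g"
    and der: "\<And>x. a < x \<Longrightarrow> x < b \<Longrightarrow> (g has_real_derivative g' x) (at x)"
    and pos: "\<And>x. a < x \<Longrightarrow> x < b \<Longrightarrow> g' x > 0"
  shows "g ` {a<..<b} = {g a<..<g b}" "inj_on g {a<..<b}"
proof -
  have mono: "g x < g y" if "a \<le> x" "x < y" "y \<le> b" for x y
  proof (rule DERIV_pos_imp_increasing_open[OF \<open>x < y\<close>])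
    show "continuous_on {x..y} g"
      using cont that by (auto intro: continuous_on_subset)
    show "\<exists>d. (g has_real_derivative d) (at z) \<and> d > 0" if "x < z" "z < y" for z
      using der[of z] pos[of z] \<open>a \<le> x\<close> \<open>y \<le> b\<close> that by auto
  qed
  have "\<exists>x\<in>{a<..<b}. g x = y" if y: "g a < y" "y < g b" for y
  proof -
    obtain x where "a \<le> x" "x \<le> b" "g x = y"
      using IVT'[of g a y b] y \<open>a < b\<close> cont by auto
    then show ?thesis using y by (cases "x = a"; cases "x = b") auto
  qed
  then show "g ` {a<..<b} = {g a<..<g b}" using mono by fastforce
  show "inj_on g {a<..<b}"
  proof (rule linorder_inj_onI)
    show "g x \<noteq> g y" if "x < y" "x \<in> {a<..<b}" "y \<in> {a<..<b}" for x y
      using mono[of x y] that by simp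
  qed auto
qed

lemma has_abs_integral_change_of_variables:
  assumes "S \<in> sets lebesgue" "inj_on g S"
    and "\<And>x. x \<in> S \<Longrightarrow> (g has_real_derivative g' x) (at x)"
  shows "has_abs_integral (\<lambda>x. \<bar>g' x\<bar> * f (g x)) I S \<longleftrightarrow> has_abs_integral f I (g ` S)"
  unfolding has_abs_integral_def
  by (rule has_absolute_integral_change_of_variables_1')
     (use assms in \<open>auto intro: has_field_derivative_at_within\<close>)

text \<open>At the endpoints \<open>g\<close> is just continuous, so \<open>g'\<close> may blow up
  there, and \<open>f\<close> may be singular at the ends of the image. Being an equivalence, the
  rule transfers integrability in either direction.\<close>

lemma has_abs_integral_substitution_increasing:
  fixes g :: "real \<Rightarrow> real"
  assumes "a < b" "continuous_on {a..b} g"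
    and der: "\<And>x. a < x \<Longrightarrow> x < b \<Longrightarrow> (g has_real_derivative g' x) (at x)"
    and "\<And>x. a < x \<Longrightarrow> x < b \<Longrightarrow> g' x > 0"
  shows "has_abs_integral (\<lambda>x. \<bar>g' x\<bar> * f (g x)) I {a<..<b} \<longleftrightarrow> has_abs_integral f I {g a<..<g b}"
  using has_abs_integral_change_of_variables[of "{a<..<b}" g g' f I]
    strict_mono_image_open_interval[OF assms] der by auto

text \<open>Image and injectivity are read off from the increasing function
  \<open>- g\<close>.\<close>

lemma has_abs_integral_substitution_decreasing:
  fixes g :: "real \<Rightarrow> real"
  assumes "a < b" "continuous_on {a..b} g"
    and der: "\<And>x. a < x \<Longrightarrow> x < b \<Longrightarrow> (g has_real_derivative g' x) (at x)"
    and neg: "\<And>x. a < x \<Longrightarrow> x < b \<Longrightarrow> g' x < 0"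
  shows "has_abs_integral (\<lambda>x. \<bar>g' x\<bar> * f (g x)) I {a<..<b} \<longleftrightarrow> has_abs_integral f I {g b<..<g a}"
proof -
  have *: "(\<lambda>x. - g x) ` {a<..<b} = {- g a<..<- g b}" "inj_on (\<lambda>x. - g x) {a<..<b}"
    by (rule strict_mono_image_open_interval[of a b "\<lambda>x. - g x" "\<lambda>x. - g' x"];
        use assms in \<open>auto intro!: continuous_on_minus DERIV_minus\<close>)+
  have "g ` {a<..<b} = uminus ` (\<lambda>x. - g x) ` {a<..<b}"
    by (simp add: image_image)
  also have "\<dots> = {g b<..<g a}"
    by (simp add: *(1))
  finally have "g ` {a<..<b} = {g b<..<g a}" .
  moreover have "inj_on g {a<..<b}"
    using *(2) by (simp add: inj_on_def)
  ultimately show ?thesis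
    using has_abs_integral_change_of_variables[of "{a<..<b}" g g' f I] der by auto
qed

subsection \<open>The elliptic kernels\<close>

abbreviation (input) k0 :: real where "k0 \<equiv> 2 - sqrt 3"

definition legendre_radical :: "real \<Rightarrow> real" where
  "legendre_radical t = sqrt ((1 - t\<^sup>2) * (1 - t\<^sup>2 / 3))"

definition pi_kernel :: "real \<Rightarrow> real" where
  "pi_kernel t = 1 / ((1 - k0 * t\<^sup>2) * legendre_radical t)"

lemma sqrt3_bounds: "(3/2::real) < sqrt 3" "sqrt 3 < (2::real)"
  by (rule real_less_rsqrt, simp add: power2_eq_square) (rule real_less_lsqrt, auto)

lemma k0_bounds: "0 < k0" "k0 < 1/2"
  using sqrt3_bounds by auto

lemma cos_pi12: "cos (pi/12) = (sqrt 3 + 1) / (2 * sqrt 2)"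
proof -
  have "cos (pi/12) = cos (pi/3 - pi/4)" by (rule arg_cong[of _ _ cos]) simp
  also have "\<dots> = (sqrt 3 + 1) / (2 * sqrt 2)"
    unfolding cos_diff by (simp add: cos_60 sin_60 cos_45 sin_45 field_simps)
  finally show ?thesis .
qed

lemma sin_pi12: "sin (pi/12) = (sqrt 3 - 1) / (2 * sqrt 2)"
proof -
  have "sin (pi/12) = sin (pi/3 - pi/4)" by (rule arg_cong[of _ _ sin]) simp
  also have "\<dots> = (sqrt 3 - 1) / (2 * sqrt 2)"
    unfolding sin_diff by (simp add: cos_60 sin_60 cos_45 sin_45 field_simps)
  finally show ?thesis .
qed

text \<open>At the lower end \<gamma> = pi/12 of the angle interval the variable t = 2 * sin
  \<gamma> equals \<open>sqrt k0\<close>; this is how \<open>sqrt k\<close> becomes a limit of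
  integration.\<close>

lemma two_sin_pi12: "2 * sin (pi/12) = sqrt k0"
proof -
  have "(2 * sin (pi/12))\<^sup>2 = k0"
    unfolding sin_pi12 by (simp add: power_mult_distrib power_divide power2_diff field_simps)
  moreover have "0 \<le> 2 * sin (pi/12)"
    using sin_gt_zero[of "pi/12"] by simp
  ultimately show ?thesis by (metis real_sqrt_unique)
qed

lemma sin_cos_bounds:
  assumes "pi/12 < x" "x < pi/6"
  shows "0 < sin x" "sin x < 1/2" "0 < cos x" "3/4 < (cos x)\<^sup>2" "4 * (sin x)\<^sup>2 < 1"
proof -
  show s: "0 < sin x" by (rule sin_gt_zero) (use assms in auto)
  show "0 < cos x" by (rule cos_gt_zero) (use assms in auto)
  show s': "sin x < 1/2"
    unfolding sin_30[symmetric] by (rule sin_monotone_2pi) (use assms in auto)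
  have "(sin x)\<^sup>2 < (1/2)\<^sup>2"
    using s s' by (intro power_strict_mono) auto
  then show "3/4 < (cos x)\<^sup>2" "4 * (sin x)\<^sup>2 < 1"
    unfolding cos_squared_eq by (auto simp: power2_eq_square)
qed

lemma legendre_radical_pos: "0 \<le> t \<Longrightarrow> t < 1 \<Longrightarrow> 0 < legendre_radical t"
  using power_strict_mono[of t 1 2] by (auto simp: legendre_radical_def intro!: mult_pos_pos)

lemma legendre_radical_continuous: "continuous_on S legendre_radical"
  unfolding legendre_radical_def by (intro continuous_intros) auto

text \<open>The inverse square root singularity at t = 1 disappears under t = sin \<theta>: the
  factor cos \<theta> cancels, and the resulting \<open>f\<close> is continuous on the closed
  interval.\<close>

lemma pi_kernel_integrable: "has_abs_integral pi_kernel (integral {0<..<1} pi_kernel) {0<..<1}"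
proof -
  define f where "f \<theta> = 1 / ((1 - k0 * (sin \<theta>)\<^sup>2) * sqrt (1 - (sin \<theta>)\<^sup>2 / 3))" for \<theta>
  have sq: "(sin \<theta>)\<^sup>2 \<le> 1" for \<theta> :: real
    by (simp add: abs_square_le_1)
  have "k0 * (sin \<theta>)\<^sup>2 < 1" for \<theta>
  proof -
    have "k0 * (sin \<theta>)\<^sup>2 \<le> k0 * 1"
      using k0_bounds sq by (intro mult_left_mono) auto
    also have "\<dots> < 1" using k0_bounds by simp
    finally show ?thesis .
  qed
  moreover have "(sin \<theta>)\<^sup>2 / 3 < 1" for \<theta> :: real
    using sq[of \<theta>] by linarith
  ultimately have "1 - k0 * (sin \<theta>)\<^sup>2 \<noteq> 0" "sqrt (1 - (sin \<theta>)\<^sup>2 / 3) \<noteq> 0" for \<theta>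
    by (metis less_irrefl right_minus_eq, metis less_irrefl right_minus_eq real_sqrt_eq_zero_cancel_iff)
  then have "continuous_on {0..pi/2} f"
    unfolding f_def by (intro continuous_intros ballI no_zero_divisors) auto
  then have "has_abs_integral f (integral {0<..<pi/2} f) {0<..<pi/2}"
    by (rule has_abs_integral_continuous)
  moreover have "f \<theta> = \<bar>cos \<theta>\<bar> * pi_kernel (sin \<theta>)" if "\<theta> \<in> {0<..<pi/2}" for \<theta>
  proof -
    have "cos \<theta> > 0" using that by (intro cos_gt_zero) auto
    moreover have "legendre_radical (sin \<theta>) = cos \<theta> * sqrt (1 - (sin \<theta>)\<^sup>2 / 3)"
      using calculation by (simp add: legendre_radical_def real_sqrt_mult flip: cos_squared_eq)
    ultimately show ?thesis by (simp add: f_def pi_kernel_def)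
  qed
  ultimately have "has_abs_integral (\<lambda>\<theta>. \<bar>cos \<theta>\<bar> * pi_kernel (sin \<theta>))
      (integral {0<..<pi/2} f) {0<..<pi/2}"
    using has_abs_integral_cong[of "{0<..<pi/2}" f "\<lambda>\<theta>. \<bar>cos \<theta>\<bar> * pi_kernel (sin \<theta>)"] by simp
  moreover have "(has_abs_integral (\<lambda>\<theta>. \<bar>cos \<theta>\<bar> * pi_kernel (sin \<theta>)) I {0<..<pi/2})
      \<longleftrightarrow> has_abs_integral pi_kernel I {sin 0<..<sin (pi/2)}" for I
    by (rule has_abs_integral_substitution_increasing)
       (auto intro!: continuous_intros derivative_eq_intros cos_gt_zero)
  ultimately have "has_abs_integral pi_kernel (integral {0<..<pi/2} f) {0<..<1}"
    by simp
  then show ?thesis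
    by (simp add: has_abs_integral_def)
qed

text \<open>For s = sin \<gamma> and c = cos \<gamma> the denominator on the left is cos (\<gamma> -
  pi/12). Multiplying by the conjugate cos (\<gamma> + pi/12) leaves a denominator in c^2 alone and
  a numerator with one term in c and one in s, each suited to its own substitution.\<close>

lemma kernel_partial_fractions:
  fixes s c :: real
  assumes "s\<^sup>2 + c\<^sup>2 = 1" "s > 0" "c > 0" "c\<^sup>2 > 3/4"
  shows "sqrt 2 / (c * cos (pi/12) + s * sin (pi/12)) =
    (sqrt 3 - 1) * (2 * c) / (1 - 4 * k0 * s\<^sup>2) - 2 * (sqrt 3 - 1) * s / (4 * c\<^sup>2 - k0)"
proof -
  define r where "r = sqrt (3::real)"
  have r: "r\<^sup>2 = 3" "r > 3/2" "r < 2" using sqrt3_bounds by (auto simp: r_def)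
  have s2: "s\<^sup>2 = 1 - c\<^sup>2" using assms by simp
  define D where "D = 4 * c\<^sup>2 - (2 - r)"
  have D: "D > 0" using assms r by (simp add: D_def)
  define N where "N = (r + 1) * c + (r - 1) * s"
  have N: "N > 0" unfolding N_def using assms r by (intro add_pos_pos mult_pos_pos) auto
  \<comment> \<open>Up to the factor 2 * sqrt 2, \<open>N\<close> and \<open>M\<close> are cos
    (\<gamma> - pi/12) and cos (\<gamma> + pi/12).\<close>
  define M where "M = (r + 1) * c - (r - 1) * s"
  have "N * M = (r\<^sup>2 + 2 * r + 1) * c\<^sup>2 - (r\<^sup>2 - 2 * r + 1) * s\<^sup>2"
    unfolding N_def M_def by (simp add: power2_eq_square algebra_simps)
  then have NM: "N * M = 2 * D"
    unfolding D_def r(1) s2 by (simp add: algebra_simps)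
  have "c * cos (pi/12) + s * sin (pi/12) = N / (2 * sqrt 2)"
    unfolding cos_pi12 sin_pi12 N_def r_def
    by (simp add: add_divide_distrib diff_divide_distrib algebra_simps)
  then have "sqrt 2 / (c * cos (pi/12) + s * sin (pi/12)) = sqrt 2 / (N / (2 * sqrt 2))"
    by (simp only:)
  also have "\<dots> = 4 / N" by simp
  also have "\<dots> = 2 * M / D"
    using N D NM by (simp add: frac_eq_eq mult.commute)
  also have "\<dots> = 2 * (r + 1) * c / D - 2 * (r - 1) * s / D"
    by (simp add: M_def right_diff_distrib diff_divide_distrib mult.assoc
        del: distrib_left_numeral right_diff_distrib_numeral)
  \<comment> \<open>Expanding the fraction by \<open>2 - r\<close> turns \<open>D\<close> into the
    rational factor of \<open>pi_kernel\<close> at t = 2 * s.\<close>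
  also have "2 * (r + 1) * c / D = (r - 1) * (2 * c) / (1 - 4 * (2 - r) * s\<^sup>2)"
  proof -
    have "1 - 4 * (2 - r) * s\<^sup>2 = (2 - r) * D"
      unfolding D_def s2 using r(1) by (simp add: power2_eq_square algebra_simps)
    moreover have "(2 - r) * (2 * (r + 1) * c) = (4 + 2 * r - 2 * r\<^sup>2) * c"
      by (simp add: power2_eq_square algebra_simps)
    then have "(r - 1) * (2 * c) = (2 - r) * (2 * (r + 1) * c)"
      unfolding r(1) by (simp add: algebra_simps)
    moreover have "2 - r \<noteq> 0" using r by simp
    ultimately show ?thesis
      by (simp only: mult_divide_mult_cancel_left not_False_eq_True)
  qed
  finally show ?thesis unfolding D_def r_def .
qed

section \<open>The angle kernel as a difference of elliptic integrands\<close>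

definition angle_kernel :: "real \<Rightarrow> real" where
  "angle_kernel \<gamma> = sqrt 2 / (cos (\<gamma> - pi/12) * legendre_radical (2 * sin \<gamma>))"

text \<open>With \<open>T = 2 * cos x\<close> the substitution is \<open>3 / T\<^sup>2 = (1 - t\<^sup>2) / (1 - t\<^sup>2 / 3)\<close>, that is,
  \<open>sqrt 3 / T = cn / dn\<close> for \<open>t = sn\<close>: a translation by the quarter period.\<close>

lemma quarter_period_derivative:
  assumes "pi/12 < x" "x < pi/6"
  shows "((\<lambda>x. sqrt ((1 - 4 * (sin x)\<^sup>2) / (3 - 4 * (sin x)\<^sup>2))) has_real_derivative
    - (8 * cos x * sin x / ((3 - 4 * (sin x)\<^sup>2)\<^sup>2 *
      sqrt ((1 - 4 * (sin x)\<^sup>2) / (3 - 4 * (sin x)\<^sup>2))))) (at x)"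
proof -
  have *: "1 - 4 * (sin x)\<^sup>2 > 0" "3 - 4 * (sin x)\<^sup>2 > 0"
    using sin_cos_bounds(5)[OF assms] by auto
  have "((\<lambda>x. (1 - 4 * (sin x)\<^sup>2) / (3 - 4 * (sin x)\<^sup>2)) has_real_derivative
      (- 16 * cos x * sin x) / (3 - 4 * (sin x)\<^sup>2)\<^sup>2) (at x)"
    using * by (auto intro!: derivative_eq_intros simp: power2_eq_square algebra_simps)
  from DERIV_chain2[OF DERIV_real_sqrt this] * show ?thesis
    by (simp add: field_simps)
qed

text \<open>The product of 1 - q^2 and 1 - q^2/3 is a perfect square, so the radical at
  \<open>q\<close> is rational in cos x up to a constant. The radical at 2 * sin x is a multiple of
  \<open>q\<close> and thus absorbs the \<open>q\<close> in the Jacobian.\<close>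

lemma quarter_period_integrand:
  assumes x: "pi/12 < x" "x < pi/6"
  defines "q \<equiv> sqrt ((1 - 4 * (sin x)\<^sup>2) / (3 - 4 * (sin x)\<^sup>2))"
  shows "8 * cos x * sin x / ((3 - 4 * (sin x)\<^sup>2)\<^sup>2 * q) *
      (1 / legendre_radical q - (sqrt 3 - 1) * pi_kernel q) =
    2 * (sqrt 3 - 1) * sin x / ((4 * (cos x)\<^sup>2 - k0) * legendre_radical (2 * sin x))"
proof -
  define r where "r = sqrt (3::real)"
  define s where "s = sin x"
  define c where "c = cos x"
  define D where "D = 3 - 4 * s\<^sup>2"
  have r: "r\<^sup>2 = 3" "r > 3/2" "r < 2" using sqrt3_bounds by (auto simp: r_def)
  have pos: "s > 0" "c > 0" "1 - 4 * s\<^sup>2 > 0" "D > 0" "c\<^sup>2 > 3/4"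
    using sin_cos_bounds[OF x] by (auto simp: s_def c_def D_def)
  have c2: "c\<^sup>2 = 1 - s\<^sup>2" by (simp add: s_def c_def cos_squared_eq)
  have q: "q > 0" "q\<^sup>2 = (1 - 4 * s\<^sup>2) / D"
    using pos by (auto simp: q_def s_def D_def)
  have D4: "D = 4 * c\<^sup>2 - 1" by (simp add: D_def c2)
  have 1: "1 - q\<^sup>2 = 2 / D" "1 - q\<^sup>2 / 3 = 8 * c\<^sup>2 / (3 * D)"
    using pos(4) unfolding q(2) by (auto simp: D_def c2 field_simps)
  have "legendre_radical q = sqrt ((4 * c / (r * D))\<^sup>2)"
    unfolding legendre_radical_def 1 power_divide power_mult_distrib r(1)
    by (simp add: power2_eq_square)
  then have Rq: "legendre_radical q = 4 * c / (r * D)"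
    using pos r by simp
  have "1 - (2 * s)\<^sup>2 = q\<^sup>2 * D" "1 - (2 * s)\<^sup>2 / 3 = D / 3"
    using q(2) pos by (simp_all add: power_mult_distrib D_def)
  then have "legendre_radical (2 * s) = sqrt ((D * q / r)\<^sup>2)"
    unfolding legendre_radical_def power_divide power_mult_distrib r(1)
    by (simp add: power2_eq_square mult_ac)
  then have R2s: "legendre_radical (2 * s) = D * q / r"
    using pos r q by simp
  have "D * q\<^sup>2 = 4 * c\<^sup>2 - 3"
    unfolding q(2) c2 using pos(4) by simp
  then have "D * (1 - (2 - r) * q\<^sup>2) = D - (2 - r) * (4 * c\<^sup>2 - 3)"
    by (metis mult.commute mult.left_commute mult.right_neutral right_diff_distrib)
  also have "\<dots> = (r - 1) * (4 * c\<^sup>2 - (2 - r))"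
    using r(1) unfolding D4 by (simp add: power2_eq_square algebra_simps)
  finally have Dk: "1 - (2 - r) * q\<^sup>2 = (r - 1) * (4 * c\<^sup>2 - (2 - r)) / D"
    using pos by (simp add: field_simps)
  define E where "E = 4 * c\<^sup>2 - (2 - r)"
  have E: "E > 0" "E - D = r - 1" using pos r by (auto simp: E_def D4)
  \<comment> \<open>The coefficient \<open>r - 1\<close> makes the difference collapse: it cancels
    the same factor in \<open>Dk\<close>, and what remains is 1 - D/E, whose numerator E - D is
    constant.\<close>
  have "1 / legendre_radical q - (r - 1) * pi_kernel q =
      (1 - (r - 1) / (1 - (2 - r) * q\<^sup>2)) / legendre_radical q"
    by (simp add: pi_kernel_def r_def diff_divide_distrib)
  also have "1 - (r - 1) / (1 - (2 - r) * q\<^sup>2) = 1 - D / E"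
    using r unfolding Dk E_def[symmetric] by simp
  also have "\<dots> = (r - 1) / E"
    using E by (simp add: field_simps)
  finally have "8 * c * s / (D\<^sup>2 * q) * (1 / legendre_radical q - (r - 1) * pi_kernel q) =
      8 * c * s / (D\<^sup>2 * q) * ((r - 1) / E / legendre_radical q)"
    by simp
  also have "\<dots> = 2 * (r - 1) * s / (E * legendre_radical (2 * s))"
    unfolding Rq R2s using pos q(1) r(2) E(1) by (simp add: power2_eq_square field_simps)
  finally show ?thesis
    unfolding D_def E_def r_def s_def c_def .
qed

text \<open>The cosine term of \<open>kernel_partial_fractions\<close> yields
  \<open>pi_kernel\<close> over (sqrt k0, 1). The sine term yields the F-integrand minus (sqrt 3 -
  1) times \<open>pi_kernel\<close> over (0, sqrt k0), and subtracting it fills in the missing part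
  of the complete integral.\<close>

lemma angle_kernel_integral:
  "has_abs_integral angle_kernel
    ((sqrt 3 - 1) * integral {0<..<1} pi_kernel - integral {0<..<sqrt k0} (\<lambda>t. 1 / legendre_radical t))
    {pi/12<..<pi/6}"
proof -
  have sk: "0 < sqrt k0" "sqrt k0 < 1" using k0_bounds by auto
  have subset: "{0<..<a} \<subseteq> {0<..<1}" "{a<..<1} \<subseteq> {0<..<1}"
    "{0<..<a} \<union> insert a {a<..<1} = {0<..<1}" if "0 < a" "a < 1" for a :: real
    using that by auto
  define P0 where "P0 = integral {0<..<sqrt k0} pi_kernel"
  define P1 where "P1 = integral {sqrt k0<..<1} pi_kernel"
  define F0 where "F0 = integral {0<..<sqrt k0} (\<lambda>t. 1 / legendre_radical t)"
  have P0: "has_abs_integral pi_kernel P0 {0<..<sqrt k0}"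
    unfolding P0_def
    by (rule has_abs_integral_subset[OF pi_kernel_integrable subset(1)[OF sk]]) simp
  have P1: "has_abs_integral pi_kernel P1 {sqrt k0<..<1}"
    unfolding P1_def
    by (rule has_abs_integral_subset[OF pi_kernel_integrable subset(2)[OF sk]]) simp
  have "has_abs_integral pi_kernel (P0 + P1) ({0<..<sqrt k0} \<union> insert (sqrt k0) {sqrt k0<..<1})"
    by (rule has_abs_integral_Un) (use P0 P1 in \<open>auto simp: has_abs_integral_insert\<close>)
  also have "{0<..<sqrt k0} \<union> insert (sqrt k0) {sqrt k0<..<1} = {0<..<1}"
    by (rule subset(3)[OF sk])
  finally have P01: "integral {0<..<1} pi_kernel = P0 + P1"
    using pi_kernel_integrable has_abs_integral_unique by blast
  have "continuous_on {0..sqrt k0} (\<lambda>t. 1 / legendre_radical t)"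
    using order.strict_trans1[OF _ sk(2)] legendre_radical_pos
    by (intro continuous_intros legendre_radical_continuous) fastforce
  then have "has_abs_integral (\<lambda>t. 1 / legendre_radical t) F0 {0<..<sqrt k0}"
    unfolding F0_def by (rule has_abs_integral_continuous)
  then have F0: "has_abs_integral (\<lambda>t. 1 / legendre_radical t - (sqrt 3 - 1) * pi_kernel t)
      (F0 - (sqrt 3 - 1) * P0) {0<..<sqrt k0}"
    by (intro has_abs_integral_diff has_abs_integral_cmult P0)
  define T where "T x = sqrt ((1 - 4 * (sin x)\<^sup>2) / (3 - 4 * (sin x)\<^sup>2))" for x
  define T' where "T' x = - (8 * cos x * sin x / ((3 - 4 * (sin x)\<^sup>2)\<^sup>2 * T x))" for x
  have Tpos: "0 < T x" if "pi/12 < x" "x < pi/6" for x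
    using sin_cos_bounds(5)[OF that] by (simp add: T_def)
  have T'neg: "T' x < 0" if "pi/12 < x" "x < pi/6" for x
    using sin_cos_bounds[OF that] Tpos[OF that] unfolding T'_def
    by (auto intro!: mult_pos_pos divide_pos_pos)
  have "(2 * sin (pi/12))\<^sup>2 = k0"
    unfolding two_sin_pi12 using k0_bounds by simp
  then have "4 * (sin (pi/12))\<^sup>2 = k0"
    by (simp add: power_mult_distrib)
  then have "T (pi/12) = sqrt ((1 - k0) / (3 - k0))"
    by (simp add: T_def)
  \<comment> \<open>Equivalent to k0^2 - 4 * k0 + 1 = 0. Hence the range of the second substitution
    ends exactly where that of the first begins.\<close>
  also have "(1 - k0) / (3 - k0) = k0"
    using sqrt3_bounds by (simp add: field_simps)
  finally have T1: "T (pi/12) = sqrt k0" .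
  have T2: "T (pi/6) = 0" by (simp add: T_def sin_30 power2_eq_square)
  \<comment> \<open>The derivative of \<open>T\<close> is unbounded near pi/6, where
    \<open>T\<close> vanishes, so continuity up to the endpoint is read off from the formula: its
    denominator stays positive.\<close>
  have "continuous_on {pi/12..pi/6} T"
  proof -
    have "(sin x)\<^sup>2 < 3/4" if "x \<in> {pi/12..pi/6}" for x
    proof -
      have "0 \<le> sin x" using that by (intro sin_ge_zero) auto
      moreover have "sin x \<le> 1/2"
        unfolding sin_30[symmetric] by (rule sin_monotone_2pi_le) (use that in auto)
      ultimately have "(sin x)\<^sup>2 \<le> (1/2)\<^sup>2" by (intro power_mono) auto
      also have "\<dots> < 3/4" by (simp add: power2_eq_square)
      finally show ?thesis .
    qed
    then show ?thesis
      unfolding T_def by (intro continuous_intros) force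
  qed
  then have "has_abs_integral (\<lambda>x. \<bar>T' x\<bar> * (1 / legendre_radical (T x) - (sqrt 3 - 1) * pi_kernel (T x))) I
        {pi/12<..<pi/6} \<longleftrightarrow>
      has_abs_integral (\<lambda>t. 1 / legendre_radical t - (sqrt 3 - 1) * pi_kernel t) I
        {T (pi/6)<..<T (pi/12)}" for I
    using quarter_period_derivative T'neg
    by (intro has_abs_integral_substitution_decreasing) (auto simp: T_def T'_def)
  with F0 have 1: "has_abs_integral
      (\<lambda>x. \<bar>T' x\<bar> * (1 / legendre_radical (T x) - (sqrt 3 - 1) * pi_kernel (T x)))
      (F0 - (sqrt 3 - 1) * P0) {pi/12<..<pi/6}"
    by (simp add: T1 T2)
  have "has_abs_integral (\<lambda>x. \<bar>2 * cos x\<bar> * pi_kernel (2 * sin x)) I {pi/12<..<pi/6} \<longleftrightarrow>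
      has_abs_integral pi_kernel I {2 * sin (pi/12)<..<2 * sin (pi/6)}" for I
    using sin_cos_bounds
    by (intro has_abs_integral_substitution_increasing)
       (auto intro!: continuous_intros derivative_eq_intros)
  with P1 have 2: "has_abs_integral (\<lambda>x. \<bar>2 * cos x\<bar> * pi_kernel (2 * sin x)) P1 {pi/12<..<pi/6}"
    unfolding two_sin_pi12 by (simp add: sin_30)
  have "has_abs_integral (\<lambda>x. (sqrt 3 - 1) * (\<bar>2 * cos x\<bar> * pi_kernel (2 * sin x)) -
      \<bar>T' x\<bar> * (1 / legendre_radical (T x) - (sqrt 3 - 1) * pi_kernel (T x)))
      ((sqrt 3 - 1) * P1 - (F0 - (sqrt 3 - 1) * P0)) {pi/12<..<pi/6}"
    by (intro has_abs_integral_diff has_abs_integral_cmult 1 2)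
  also have "(sqrt 3 - 1) * P1 - (F0 - (sqrt 3 - 1) * P0) = (sqrt 3 - 1) * integral {0<..<1} pi_kernel - F0"
    unfolding P01 by (simp add: algebra_simps)
  finally have "has_abs_integral (\<lambda>x. (sqrt 3 - 1) * (\<bar>2 * cos x\<bar> * pi_kernel (2 * sin x)) -
      \<bar>T' x\<bar> * (1 / legendre_radical (T x) - (sqrt 3 - 1) * pi_kernel (T x)))
      ((sqrt 3 - 1) * integral {0<..<1} pi_kernel - F0) {pi/12<..<pi/6}" .
  moreover have "(sqrt 3 - 1) * (\<bar>2 * cos x\<bar> * pi_kernel (2 * sin x)) -
      \<bar>T' x\<bar> * (1 / legendre_radical (T x) - (sqrt 3 - 1) * pi_kernel (T x)) = angle_kernel x"
    if "x \<in> {pi/12<..<pi/6}" for x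
  proof -
    have x: "pi/12 < x" "x < pi/6" using that by auto
    note b = sin_cos_bounds[OF x]
    have "\<bar>T' x\<bar> * (1 / legendre_radical (T x) - (sqrt 3 - 1) * pi_kernel (T x)) =
        2 * (sqrt 3 - 1) * sin x / (4 * (cos x)\<^sup>2 - k0) / legendre_radical (2 * sin x)"
      using quarter_period_integrand[OF x] unfolding abs_of_neg[OF T'neg[OF x]]
      by (simp add: T_def T'_def)
    moreover have "(sqrt 3 - 1) * (\<bar>2 * cos x\<bar> * pi_kernel (2 * sin x)) =
        (sqrt 3 - 1) * (2 * cos x) / (1 - 4 * k0 * (sin x)\<^sup>2) / legendre_radical (2 * sin x)"
      using b by (simp add: pi_kernel_def power_mult_distrib mult.assoc mult.left_commute)
    moreover have "angle_kernel x =
        (sqrt 2 / (cos x * cos (pi/12) + sin x * sin (pi/12))) / legendre_radical (2 * sin x)"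
      by (simp add: angle_kernel_def cos_diff)
    ultimately show ?thesis
      using kernel_partial_fractions[of "sin x" "cos x"] b by (simp only: diff_divide_distrib sin_cos_squared_add)
  qed
  ultimately show ?thesis
    unfolding F0_def by (rule has_abs_integral_cong[THEN iffD1, rotated])
qed

section \<open>The integrand on the half-line and its reduction to the angle kernel\<close>

definition phi :: "real \<Rightarrow> real" where
  "phi x = 1 + 4 * x\<^sup>2 / (3 * (1 + x\<^sup>2)\<^sup>2)"

text \<open>The integrand of \<open>I\<close>, with roots in place of real exponents.\<close>

definition table_kernel :: "real \<Rightarrow> real" where
  "table_kernel x = 1 / (sqrt (1 + x\<^sup>2) ^ 3 * sqrt (phi x + sqrt (phi x)))"

lemma one_plus_square_pos: "0 < 1 + (x::real)\<^sup>2"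
  by (simp add: add_pos_nonneg)

lemma phi_ge_1: "phi x \<ge> 1"
  by (simp add: phi_def)

text \<open>For x different from 0, \<open>phi\<close> depends only on x/(1 + x^2) = 1/(x + 1/x),
  which is symmetric in x and 1/x.\<close>

lemma phi_inverse:
  assumes "x \<noteq> 0"
  shows "phi (1 / x) = phi x"
proof -
  have "1 + (1/x)\<^sup>2 = (1 + x\<^sup>2) / x\<^sup>2"
    using assms by (simp add: field_simps)
  then have "(1/x)\<^sup>2 / (3 * (1 + (1/x)\<^sup>2)\<^sup>2) = x\<^sup>2 / (3 * (1 + x\<^sup>2)\<^sup>2)"
    using assms by (simp add: power_divide power2_eq_square)
  then show ?thesis
    by (simp only: phi_def times_divide_eq_right[symmetric])
qed

text \<open>The cube comes from (1 + x^2)^(3/2). Together with the Jacobian 1/x^2 it gives the part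
  over (1, \<infinity>), folded onto (0, 1), the weight x.\<close>

lemma table_kernel_inverse:
  assumes "x > 0"
  shows "table_kernel (1 / x) = x ^ 3 * table_kernel x"
proof -
  have "1 + (1/x)\<^sup>2 = (1 + x\<^sup>2) / x\<^sup>2"
    using assms by (simp add: field_simps)
  then have "sqrt (1 + (1/x)\<^sup>2) = sqrt (1 + x\<^sup>2) / x"
    using assms by (simp add: real_sqrt_divide)
  then show ?thesis
    using assms by (simp add: table_kernel_def phi_inverse power_divide)
qed

lemma table_kernel_continuous: "continuous_on S table_kernel"
proof -
  have "sqrt (phi x + sqrt (phi x)) \<noteq> 0" for x
    using phi_ge_1[of x] add_pos_nonneg[of "phi x" "sqrt (phi x)"] by simp
  moreover have "sqrt (1 + x\<^sup>2) \<noteq> 0" "1 + x\<^sup>2 \<noteq> 0" for x :: real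
    using one_plus_square_pos[of x] by auto
  moreover have "continuous_on S phi"
    unfolding phi_def using calculation(3) by (intro continuous_intros) auto
  ultimately show ?thesis
    unfolding table_kernel_def by (intro continuous_intros ballI no_zero_divisors power_not_zero)
qed

text \<open>The function is \<gamma> solved from w = sqrt 3 * tan (2 * \<gamma> - pi/6) with w = 2 *
  x/(1 + x^2); \<open>phi x\<close> appears as 1 + w^2/3 from the derivative of
  \<open>arctan\<close>.\<close>

lemma angle_derivative:
  "((\<lambda>x. (arctan (2 * x / (sqrt 3 * (1 + x\<^sup>2))) + pi/6) / 2) has_real_derivative
    (1 - x\<^sup>2) / (sqrt 3 * (1 + x\<^sup>2)\<^sup>2 * phi x)) (at x)"
proof -
  have p: "1 + x\<^sup>2 \<noteq> 0" using one_plus_square_pos[of x] by simp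
  have "((\<lambda>x. 2 * x / (1 + x\<^sup>2)) has_real_derivative 2 * (1 - x\<^sup>2) / (1 + x\<^sup>2)\<^sup>2) (at x)"
    using p by (auto intro!: derivative_eq_intros simp: power2_eq_square algebra_simps)
  from DERIV_cdivide[OF this, of "sqrt 3"]
  have "((\<lambda>x. 2 * x / (sqrt 3 * (1 + x\<^sup>2))) has_real_derivative 2 * (1 - x\<^sup>2) / (sqrt 3 * (1 + x\<^sup>2)\<^sup>2)) (at x)"
    by (simp add: mult.commute)
  from DERIV_chain2[OF DERIV_arctan this]
  have "((\<lambda>x. arctan (2 * x / (sqrt 3 * (1 + x\<^sup>2)))) has_real_derivative
     inverse (1 + (2 * x / (sqrt 3 * (1 + x\<^sup>2)))\<^sup>2) * (2 * (1 - x\<^sup>2) / (sqrt 3 * (1 + x\<^sup>2)\<^sup>2))) (at x)" .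
  moreover have "1 + (2 * x / (sqrt 3 * (1 + x\<^sup>2)))\<^sup>2 = phi x"
    by (simp add: phi_def power_divide power_mult_distrib)
  ultimately have "((\<lambda>x. (arctan (2 * x / (sqrt 3 * (1 + x\<^sup>2))) + pi/6) / 2) has_real_derivative
     (inverse (phi x) * (2 * (1 - x\<^sup>2) / (sqrt 3 * (1 + x\<^sup>2)\<^sup>2)) + 0) / 2) (at x)"
    by (intro DERIV_cdivide DERIV_add DERIV_const) (simp only:)
  moreover have "(inverse b * (2 * p / q) + 0) / 2 = p / (q * b)" for b p q :: real
    by (simp add: field_simps)
  ultimately show ?thesis
    by (simp only:)
qed

text \<open>The half-angle formula expresses cos (\<gamma> - pi/12) = cos (a/2) through
  \<open>y\<close>. The radical is a multiple of sqrt (1 - w) = (1 - x)/sqrt (1 + x^2), divided by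
  \<open>y\<close>; cancelling 1 - x against 1 - x^2 leaves the weight 1 + x.\<close>

lemma angle_integrand:
  assumes "0 < x" "x < 1"
  shows "(1 - x\<^sup>2) / (sqrt 3 * (1 + x\<^sup>2)\<^sup>2 * phi x) *
      angle_kernel ((arctan (2 * x / (sqrt 3 * (1 + x\<^sup>2))) + pi/6) / 2) =
    sqrt 2 * ((1 + x) * table_kernel x)"
proof -
  define r where "r = sqrt (3::real)"
  define w where "w = 2 * x / (1 + x\<^sup>2)"
  define y where "y = sqrt (phi x)"
  define a where "a = arctan (w / r)"
  define u where "u = sqrt (1 + x\<^sup>2)"
  define v where "v = sqrt y"
  define z where "z = sqrt (y + 1)"
  define \<gamma> where "\<gamma> = (a + pi/6) / 2"
  have r: "r\<^sup>2 = 3" "r > 0" by (auto simp: r_def)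
  have y: "y \<ge> 1" "y\<^sup>2 = phi x" using phi_ge_1[of x] by (auto simp: y_def)
  have u: "u > 0" "u\<^sup>2 = 1 + x\<^sup>2" using one_plus_square_pos[of x] by (auto simp: u_def)
  have v: "v > 0" "v\<^sup>2 = y" and z: "z > 0" "z\<^sup>2 = y + 1" using y by (auto simp: v_def z_def)
  have yw: "1 + (w / r)\<^sup>2 = y\<^sup>2"
    unfolding y(2) phi_def w_def power_divide power_mult_distrib r(1) by simp
  have ca: "cos a = 1 / y" and sa: "sin a = w / (r * y)"
    using y(1) by (simp_all add: a_def cos_arctan sin_arctan yw)
  have w1: "1 - w = ((1 - x) / u)\<^sup>2"
    unfolding w_def power_divide u(2) using one_plus_square_pos[of x]
    by (simp add: field_simps power2_eq_square)
  have "- (pi / 2) < a" "a < pi / 2"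
    using arctan_bounded[of "w / r"] by (auto simp: a_def)
  then have "cos (a / 2) > 0" by (intro cos_gt_zero_pi) auto
  moreover have "(cos (a / 2))\<^sup>2 = (z / (sqrt 2 * v))\<^sup>2"
    using cos_double_cos[of "a / 2"] y(1) unfolding power_divide power_mult_distrib v(2) z(2)
    by (simp add: ca field_simps)
  ultimately have c: "cos (a / 2) = z / (sqrt 2 * v)"
    using z(1) v(1) by (simp add: power2_eq_iff_nonneg)
  \<comment> \<open>With C = cos (2 * \<gamma>) the two factors under the radical become 2 * C - 1
    and (2 * C + 1)/3.\<close>
  have s: "(2 * sin \<gamma>)\<^sup>2 = 2 - 2 * cos (2 * \<gamma>)"
    using cos_double_sin[of \<gamma>] by (simp add: power_mult_distrib)
  have "2 * \<gamma> = a + pi/6" by (simp add: \<gamma>_def)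
  then have "cos (2 * \<gamma>) = cos (a + pi/6)" by simp
  also have "\<dots> = (1 / y) * (r / 2) - (w / (r * y)) / 2"
    unfolding cos_add ca sa by (simp add: cos_30 sin_30 r_def)
  also have "\<dots> = (3 - w) / (2 * r * y)"
    using r y(1) by (simp add: field_simps flip: power2_eq_square)
  finally have c2: "4 * (cos (2 * \<gamma>))\<^sup>2 = (3 - w)\<^sup>2 / (3 * y\<^sup>2)"
    by (simp add: power_divide power_mult_distrib r(1))
  have "(1 - (2 * sin \<gamma>)\<^sup>2) * (1 - (2 * sin \<gamma>)\<^sup>2 / 3) = (4 * (cos (2 * \<gamma>))\<^sup>2 - 1) / 3"
    unfolding s by (simp add: power2_eq_square field_simps)
  also have "\<dots> = ((3 - w)\<^sup>2 - 3 * y\<^sup>2) / (9 * y\<^sup>2)"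
    unfolding c2 using y(1) by (simp add: field_simps)
  also have "3 * y\<^sup>2 = 3 + w\<^sup>2"
    unfolding yw[symmetric] power_divide r(1) by simp
  also have "((3 - w)\<^sup>2 - (3 + w\<^sup>2)) / (9 * y\<^sup>2) = 2 * (1 - w) / (3 * y\<^sup>2)"
    using y(1) by (simp add: field_simps power2_eq_square)
  also have "\<dots> = (sqrt 2 * (1 - x) / (u * r * v\<^sup>2))\<^sup>2"
    unfolding w1 v(2) power_divide power_mult_distrib r(1) by simp
  finally have radical: "legendre_radical (2 * sin \<gamma>) = sqrt 2 * (1 - x) / (u * r * v\<^sup>2)"
    unfolding legendre_radical_def using assms u(1) r(2) v(1) by simp
  have "\<gamma> - pi/12 = a / 2" by (simp add: \<gamma>_def add_divide_distrib)
  then have "angle_kernel \<gamma> = sqrt 2 / (z / (sqrt 2 * v) * (sqrt 2 * (1 - x) / (u * r * v\<^sup>2)))"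
    unfolding angle_kernel_def radical by (simp only: c)
  also have "\<dots> = sqrt 2 * u * r * v ^ 3 / (z * (1 - x))"
    by (simp add: power2_eq_square power3_eq_cube)
  finally have "(1 - x\<^sup>2) / (r * (u\<^sup>2)\<^sup>2 * y\<^sup>2) * angle_kernel \<gamma> =
      (1 - x) * (1 + x) / (r * (u\<^sup>2)\<^sup>2 * (v\<^sup>2)\<^sup>2) * (sqrt 2 * u * r * v ^ 3 / (z * (1 - x)))"
    unfolding v(2) by (simp add: power2_eq_square algebra_simps)
  also have "\<dots> = sqrt 2 * ((1 + x) * (1 / (u ^ 3 * (v * z))))"
    using u(1) v(1) r(2) z(1) assms by (simp add: field_simps power2_eq_square power3_eq_cube)
  also have "1 / (u ^ 3 * (v * z)) = table_kernel x"
    unfolding table_kernel_def y(2)[symmetric] u_def v_def z_def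
    using y(1) by (simp add: power2_eq_square algebra_simps flip: real_sqrt_mult)
  finally show ?thesis
    unfolding u(2) y(2) \<gamma>_def a_def w_def r_def by (simp add: mult.commute)
qed

text \<open>In the weight 1 + x, the summand 1 accounts for (0, 1) and the summand x for (1,
  \<infinity>), unfolded by x -> 1/x.\<close>

lemma table_kernel_integral:
  assumes "has_abs_integral angle_kernel J {pi/12<..<pi/6}"
  shows "has_abs_integral table_kernel (J / sqrt 2) {0<..}"
proof -
  define g where "g x = (arctan (2 * x / (sqrt 3 * (1 + x\<^sup>2))) + pi/6) / 2" for x :: real
  define g' where "g' x = (1 - x\<^sup>2) / (sqrt 3 * (1 + x\<^sup>2)\<^sup>2 * phi x)" for x
  have g'_pos: "g' x > 0" if "0 < x" "x < 1" for x
    using that phi_ge_1[of x] one_plus_square_pos[of x] power_strict_mono[of x 1 2]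
    unfolding g'_def by (intro divide_pos_pos mult_pos_pos) auto
  have der: "(g has_real_derivative g' x) (at x)" for x
    unfolding g_def g'_def by (rule angle_derivative)
  have "has_abs_integral (\<lambda>x. \<bar>g' x\<bar> * angle_kernel (g x)) J {0<..<1} \<longleftrightarrow>
      has_abs_integral angle_kernel J {g 0<..<g 1}"
    using der g'_pos by (intro has_abs_integral_substitution_increasing)
      (auto intro!: continuous_at_imp_continuous_on DERIV_isCont)
  moreover have "arctan (1 / sqrt 3) = pi / 6"
    by (rule arctan_unique) (auto simp: tan_30)
  then have "g 0 = pi/12" "g 1 = pi/6"
    by (simp_all add: g_def)
  moreover have "\<bar>g' x\<bar> * angle_kernel (g x) = sqrt 2 * ((1 + x) * table_kernel x)" if "x \<in> {0<..<1}" for x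
  proof -
    have "\<bar>g' x\<bar> = g' x" using g'_pos[of x] that by simp
    moreover have "g' x * angle_kernel (g x) = sqrt 2 * ((1 + x) * table_kernel x)"
      unfolding g_def g'_def using that by (intro angle_integrand) auto
    ultimately show ?thesis by (simp only:)
  qed
  then have "has_abs_integral (\<lambda>x. \<bar>g' x\<bar> * angle_kernel (g x)) J {0<..<1} \<longleftrightarrow>
      has_abs_integral (\<lambda>x. sqrt 2 * ((1 + x) * table_kernel x)) J {0<..<1}"
    by (rule has_abs_integral_cong)
  ultimately have "has_abs_integral (\<lambda>x. sqrt 2 * ((1 + x) * table_kernel x)) J {0<..<1}"
    using assms by simp
  from has_abs_integral_cmult[OF this, of "1 / sqrt 2"]
  have 1: "has_abs_integral (\<lambda>x. (1 + x) * table_kernel x) (J / sqrt 2) {0<..<1}"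
    by simp
  \<comment> \<open>Isolating the summand x requires the kernel to be integrable by itself on (0,
    1), which its continuity on [0, 1] gives.\<close>
  define K where "K = integral {0<..<1} table_kernel"
  have 2: "has_abs_integral table_kernel K {0<..<1}"
    unfolding K_def by (intro has_abs_integral_continuous table_kernel_continuous)
  have "has_abs_integral (\<lambda>x. x * table_kernel x) (J / sqrt 2 - K) {0<..<1}"
    using has_abs_integral_diff[OF 1 2] by (simp add: algebra_simps)
  moreover have "(\<lambda>x. 1 / x) ` {1<..} = {0<..<1::real}"
  proof (intro equalityI subsetI)
    fix y :: real assume "y \<in> {0<..<1}"
    then show "y \<in> (\<lambda>x. 1 / x) ` {1<..}" by (intro image_eqI[of _ _ "1 / y"]) auto
  qed auto
  moreover have "has_abs_integral (\<lambda>x. \<bar>- 1 / x\<^sup>2\<bar> * (1 / x * table_kernel (1 / x))) I {1<..} \<longleftrightarrow>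
      has_abs_integral (\<lambda>x. x * table_kernel x) I ((\<lambda>x. 1 / x) ` {1<..})" for I
    by (rule has_abs_integral_change_of_variables)
       (auto simp: inj_on_def power2_eq_square intro!: derivative_eq_intros)
  \<comment> \<open>The factors 1/x^2 and 1/x cancel the cube in
    \<open>table_kernel_inverse\<close>.\<close>
  moreover have "has_abs_integral (\<lambda>x. \<bar>- 1 / x\<^sup>2\<bar> * (1 / x * table_kernel (1 / x))) I {1<..} \<longleftrightarrow>
      has_abs_integral table_kernel I {1<..}" for I
    by (rule has_abs_integral_cong) (simp add: table_kernel_inverse power2_eq_square power3_eq_cube)
  ultimately have 3: "has_abs_integral table_kernel (J / sqrt 2 - K) {1<..}"
    by simp
  have "has_abs_integral table_kernel (K + (J / sqrt 2 - K)) ({0<..<1} \<union> insert 1 {1<..})"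
    by (rule has_abs_integral_Un) (use 2 3 in \<open>auto simp: has_abs_integral_insert\<close>)
  also have "{0<..<1} \<union> insert 1 {1<..} = {0::real<..}" by auto
  finally show ?thesis by simp
qed

section \<open>Identification with the Legendre forms F and Pi\<close>

theorem theorem10p2:
  fixes k \<alpha> I :: real and \<phi> :: "real \<Rightarrow> real"
  assumes k_eq: "k = 2 - sqrt 3"
    and \<alpha>_eq: "\<alpha> = arcsin (sqrt k)"
    and \<phi>_eq: "\<And>x. \<phi> x = 1 + 4 * x\<^sup>2 / (3 * (1 + x\<^sup>2)\<^sup>2)"
    and I_eq: "I = (LBINT x=0..\<infinity>. 1 / ((1 + x\<^sup>2) powr (3/2) * (\<phi> x + sqrt (\<phi> x)) powr (1/2)))"
  shows "sqrt 2 * I =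
    (sqrt 3 - 1) * elliptic_Pi (pi / 2) k (3 powr (- 1/2)) - elliptic_F \<alpha> (3 powr (- 1/2))"
proof -
  \<comment> \<open>The right-hand side of the claim, written with gauge integrals.\<close>
  define J where "J = (sqrt 3 - 1) * integral {0<..<1} pi_kernel -
      integral {0<..<sqrt k0} (\<lambda>t. 1 / legendre_radical t)"
  have l: "(3 powr - (1/2))\<^sup>2 = (1/3 :: real)"
    by (simp add: power2_eq_square flip: powr_add)
  have k: "0 < sqrt k" "sqrt k < 1" using k0_bounds by (auto simp: k_eq)
  have "sin \<alpha> = sqrt k" unfolding \<alpha>_eq by (rule sin_arcsin) (use k in linarith)+
  have [measurable]: "legendre_radical \<in> borel_measurable borel"
    by (intro borel_measurable_continuous_onI legendre_radical_continuous)
  have "1 / ((1 + x\<^sup>2) powr (3/2) * (\<phi> x + sqrt (\<phi> x)) powr (1/2)) = table_kernel x" for x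
  proof -
    have "\<phi> x = phi x" by (simp add: \<phi>_eq phi_def)
    moreover have "(1 + x\<^sup>2) powr (3/2) = sqrt (1 + x\<^sup>2) ^ 3"
      using one_plus_square_pos[of x] by (simp add: powr_half_sqrt[symmetric] powr_power)
    ultimately show ?thesis
      using phi_ge_1[of x] by (simp add: table_kernel_def powr_half_sqrt)
  qed
  then have "I = (LBINT x:{0<..}. table_kernel x)"
    unfolding I_eq by (simp add: interval_lebesgue_integral_0_infty)
  also have "\<dots> = J / sqrt 2"
    by (rule lborel_integral_eq_has_abs_integral)
       (auto intro!: table_kernel_integral borel_measurable_continuous_onI table_kernel_continuous
         simp: J_def angle_kernel_integral)
  finally have "sqrt 2 * I = J" by simp
  moreover have "elliptic_Pi (pi / 2) k (3 powr (- 1/2)) = (LBINT x:{0<..<1}. pi_kernel x)"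
    by (simp add: elliptic_Pi_def l pi_kernel_def legendre_radical_def k_eq interval_lebesgue_integral_le_eq
      einterval_eq zero_ereal_def one_ereal_def)
  moreover have "(LBINT x:{0<..<1}. pi_kernel x) = integral {0<..<1} pi_kernel"
    by (rule lborel_integral_eq_has_abs_integral[OF pi_kernel_integrable]) (auto simp: pi_kernel_def[abs_def])
  moreover have "elliptic_F \<alpha> (3 powr (- 1/2)) = (LBINT t:{0<..<sqrt k}. 1 / legendre_radical t)"
    using k by (simp add: elliptic_F_def l legendre_radical_def \<open>sin \<alpha> = sqrt k\<close> interval_lebesgue_integral_le_eq
      einterval_eq zero_ereal_def)
  moreover have "(LBINT t:{0<..<sqrt k}. 1 / legendre_radical t) =
      integral {0<..<sqrt k} (\<lambda>t. 1 / legendre_radical t)"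
  \<comment> \<open>As sqrt k < 1, this integrand is continuous up to the upper limit.\<close>
  proof (rule lborel_integral_eq_has_abs_integral)
    show "has_abs_integral (\<lambda>t. 1 / legendre_radical t)
        (integral {0<..<sqrt k} (\<lambda>t. 1 / legendre_radical t)) {0<..<sqrt k}"
      using order.strict_trans1[OF _ k(2)] legendre_radical_pos
      by (intro has_abs_integral_continuous continuous_intros legendre_radical_continuous) fastforce
  qed auto
  ultimately show ?thesis
    by (simp add: J_def k_eq)
qed

end
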